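(* If $r \in (0, 1]$ and $\phi \in (0, \pi)$, then $$\sum_{k=1}^{\infty}(-1)^{k+1}\frac{r^k\cos(k\phi)}{k+2} < \sum_{k=1}^{\infty}(-1)^{k+1}\frac{r^k}{k+2}.$$
   Context: The infinite series are understood as limits of their partial sums (for $r=1$ they need not converge absolutely). *)

theory Defs
  imports Complex_Main
begin

end

theory Submission
  imports Defs "HOL-Analysis.Analysis"
begin

text \<open>With \<open>w = r e\<^sup>i\<^sup>\<phi>\<close> and \<open>1/(k + 2) = \<integral>\<^sub>0\<^sup>1 t\<^sup>k\<^sup>+\<^sup>1 dt\<close>, the geometric series turns
  \<open>\<Sum>k\<ge>0. (-w)\<^sup>k/(k + 2)\<close> into \<open>\<integral>\<^sub>0\<^sup>1 t/(1 + t w) dt\<close>. The real parts of these integrands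
  for \<open>w = r e\<^sup>i\<^sup>\<phi>\<close> and \<open>w = r\<close> compare pointwise: with \<open>s = r t\<close>, their difference is
  \<open>t s (1 - s) (1 - cos \<phi>) / ((1 + s) |1 + s e\<^sup>i\<^sup>\<phi>|\<^sup>2) > 0\<close> for \<open>0 < t < 1\<close>.\<close>

text \<open>A zero would give \<open>t * norm w = 1\<close> with both factors at most 1, so
  \<open>t = 1\<close> and \<open>w = -1\<close>. Allowing \<open>norm w = 1\<close> is what covers
  the case r = 1.\<close>

lemma one_plus_scaled_nonzero:
  fixes w :: complex and t :: real
  assumes "norm w \<le> 1" "w \<noteq> -1" "t \<in> {0..1}"
  shows "1 + of_real t * w \<noteq> 0"
proof
  assume "1 + of_real t * w = 0"
  then have eq: "of_real t * w = -1"
    by (simp add: add_eq_0_iff)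
  then have "t * norm w = 1"
    using assms(3) by (metis abs_of_nonneg atLeastAtMost_iff norm_minus_cancel norm_mult norm_of_real norm_one)
  moreover have "t * norm w \<le> t"
    using assms by (simp add: mult_left_le)
  ultimately have "t = 1"
    using assms(3) by simp
  with eq assms(2) show False
    by simp
qed

lemma continuous_on_div_one_plus_scaled:
  fixes w :: complex
  assumes "norm w \<le> 1" "w \<noteq> -1" "continuous_on {0..1} f"
  shows "continuous_on {0..1} (\<lambda>t. f t / (1 + of_real t * w))"
  using one_plus_scaled_nonzero[OF assms(1,2)] by (intro continuous_intros assms(3)) auto

lemma has_integral_power_unit: "((\<lambda>t. t ^ n) has_integral 1 / real (Suc n)) {0..1}"
proof -
  have "((\<lambda>t. t ^ n) has_integral (1 ^ Suc n / real (Suc n) - 0 ^ Suc n / real (Suc n))) {0..1}"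
    by (rule fundamental_theorem_of_calculus)
      (auto simp flip: has_real_derivative_iff_has_vector_derivative power_Suc intro!: derivative_eq_intros simp del: of_nat_Suc)
  then show ?thesis
    by simp
qed

text \<open>Subtracting the first n terms of the geometric series from the integrand leaves a
  remainder of norm at most \<open>C * t ^ Suc n\<close>, whose integral \<open>C / (n + 2)\<close>
  tends to 0. This needs no absolute convergence, so it works on the unit circle too.\<close>

lemma sums_integral_unit:
  fixes w :: complex
  assumes w: "norm w \<le> 1" "w \<noteq> -1"
  shows "(\<lambda>n. (- w) ^ n / of_nat (n + 2)) sums
    integral {0..1} (\<lambda>t. of_real t / (1 + of_real t * w))"
proof -
  define I where "I = integral {0..1} (\<lambda>t. of_real t / (1 + of_real t * w))"
  have I: "((\<lambda>t. of_real t / (1 + of_real t * w)) has_integral I) {0..1}"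
    unfolding I_def using w
    by (intro integrable_integral integrable_continuous_real continuous_on_div_one_plus_scaled)
      (auto intro!: continuous_intros)
  \<comment> \<open>The constant C bounds the reciprocal uniformly in t; it may depend on w and
    blows up as w approaches -1.\<close>
  have "compact ((\<lambda>t. 1 / (1 + of_real t * w)) ` {0..1::real})"
    using w by (intro compact_continuous_image continuous_on_div_one_plus_scaled) auto
  then obtain C where C: "C > 0" "\<And>t. t \<in> {0..1::real} \<Longrightarrow> norm (1 / (1 + of_real t * w)) \<le> C"
    by (force simp: bounded_pos dest!: compact_imp_bounded)
  have bound: "norm (I - (\<Sum>k<n. (- w) ^ k / of_nat (k + 2))) \<le> C * (1 / real (n + 2))" for n
  proof -
    have "((\<lambda>t. of_real (t ^ Suc k)) has_integral (of_real (1 / real (Suc (Suc k))) :: complex)) {0..1}" for k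
      by (intro has_integral_of_real has_integral_power_unit)
    then have "((\<lambda>t. (- w) ^ k * of_real (t ^ Suc k)) has_integral (- w) ^ k / of_nat (k + 2)) {0..1}" for k
      using has_integral_mult_right[of "\<lambda>t. of_real (t ^ Suc k)" "of_real (1 / real (Suc (Suc k)))" "{0..1}" "(- w) ^ k"]
      by (simp del: of_real_power)
    then have 1: "((\<lambda>t. of_real t / (1 + of_real t * w) - (\<Sum>k<n. (- w) ^ k * of_real (t ^ Suc k)))
        has_integral I - (\<Sum>k<n. (- w) ^ k / of_nat (k + 2))) {0..1}"
      by (intro has_integral_diff I has_integral_sum) auto
    have 2: "((\<lambda>t. C * t ^ Suc n) has_integral C * (1 / real (n + 2))) {0..1}"
      using has_integral_mult_right[OF has_integral_power_unit[of "Suc n"], of C] by simp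
    have "norm (of_real t / (1 + of_real t * w) - (\<Sum>k<n. (- w) ^ k * of_real (t ^ Suc k)))
        \<le> C * t ^ Suc n" if t: "t \<in> {0..1}" for t
    proof -
      have nz: "1 + of_real t * w \<noteq> 0"
        using w t by (rule one_plus_scaled_nonzero)
      have "(\<Sum>k<n. (- w) ^ k * of_real (t ^ Suc k)) = of_real t * (\<Sum>k<n. (- (of_real t * w)) ^ k)"
        by (simp add: sum_distrib_left mult_ac flip: power_mult_distrib)
      also have "\<dots> = of_real t * ((1 - (- (of_real t * w)) ^ n) / (1 + of_real t * w))"
        using one_diff_power_eq[of "- (of_real t * w)" n] nz by simp
      finally have "of_real t / (1 + of_real t * w) - (\<Sum>k<n. (- w) ^ k * of_real (t ^ Suc k))
          = of_real t * (- (of_real t * w)) ^ n * (1 / (1 + of_real t * w))"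
        using nz by (simp add: field_simps)
      also have "norm \<dots> = t ^ Suc n * (norm w ^ n * norm (1 / (1 + of_real t * w)))"
        using t by (simp add: norm_mult norm_power norm_divide power_mult_distrib)
      \<comment> \<open>The decay has to come from \<open>t ^ Suc n\<close>: for
        \<open>norm w = 1\<close> the factor \<open>norm w ^ n\<close> is merely bounded by
        1.\<close>
      also have "\<dots> \<le> t ^ Suc n * (1 * C)"
        using t w C by (intro mult_left_mono mult_mono power_le_one) auto
      finally show ?thesis
        by (simp add: mult_ac)
    qed
    from integral_norm_bound_integral[OF has_integral_integrable[OF 1] has_integral_integrable[OF 2] this]
    show ?thesis
      unfolding integral_unique[OF 1] integral_unique[OF 2] .
  qed
  have "(\<lambda>n. C * (1 / real (n + 2))) \<longlonglongrightarrow> 0"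
    using LIMSEQ_ignore_initial_segment[OF lim_const_over_n[of C], of 2] by simp
  then have "(\<lambda>n. I - (\<Sum>k<n. (- w) ^ k / of_nat (k + 2))) \<longlonglongrightarrow> 0"
    by (rule Lim_null_comparison[OF always_eventually[OF allI, OF bound]])
  from tendsto_diff[OF tendsto_const[of I] this]
  show ?thesis
    by (simp add: sums_def I_def)
qed

lemma Re_inverse_one_plus_less:
  fixes s \<phi> :: real
  assumes "0 < s" "s < 1" "cos \<phi> < 1"
  shows "Re (1 / (1 + of_real s)) < Re (1 / (1 + of_real s * cis \<phi>))"
proof -
  have "(1 + s * cos \<phi>)\<^sup>2 + (s * sin \<phi>)\<^sup>2 = 1 + 2 * s * cos \<phi> + s\<^sup>2 * ((cos \<phi>)\<^sup>2 + (sin \<phi>)\<^sup>2)"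
    by algebra
  then have norm_eq: "(1 + s * cos \<phi>)\<^sup>2 + (s * sin \<phi>)\<^sup>2 = 1 + 2 * s * cos \<phi> + s\<^sup>2"
    by simp
  have "s * -1 \<le> s * cos \<phi>"
    using assms by (intro mult_left_mono) auto
  then have "0 < (1 + s * cos \<phi>)\<^sup>2"
    using assms by simp
  then have pos: "0 < 1 + 2 * s * cos \<phi> + s\<^sup>2"
    by (metis norm_eq add_pos_nonneg zero_le_power2)
  \<comment> \<open>This product is exactly \<open>(1 + s * cos \<phi>) * (1 + s) - (1 + 2 * s * cos
    \<phi> + s\<^sup>2)\<close>, the gap left after cross-multiplying the two real parts.\<close>
  have "0 < s * (1 - s) * (1 - cos \<phi>)"
    using assms by simp
  then have "1 + 2 * s * cos \<phi> + s\<^sup>2 < (1 + s * cos \<phi>) * (1 + s)"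
    by (simp add: algebra_simps power2_eq_square)
  then have "1 / (1 + s) < (1 + s * cos \<phi>) / (1 + 2 * s * cos \<phi> + s\<^sup>2)"
    using pos assms by (simp add: field_simps)
  moreover have "Re (1 / (1 + of_real s)) = 1 / (1 + s)"
    by (metis Re_complex_of_real of_real_1 of_real_add of_real_divide)
  ultimately show ?thesis
    by (simp add: Re_divide norm_eq)
qed

theorem theorem1p1:
  fixes r \<phi> :: real
  assumes "r \<in> {0<..1}" and "\<phi> \<in> {0<..<pi}"
  defines "a \<equiv> \<lambda>k::nat. (-1) ^ (k + 1) * (r ^ k * cos (real k * \<phi>) / real (k + 2))"
    and "b \<equiv> \<lambda>k::nat. (-1) ^ (k + 1) * (r ^ k / real (k + 2))"
  shows "summable (\<lambda>n. a (Suc n)) \<and> summable (\<lambda>n. b (Suc n)) \<and>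
    (\<Sum>n. a (Suc n)) < (\<Sum>n. b (Suc n))"
proof -
  define J where "J \<theta> = integral {0..1} (\<lambda>t. of_real t / (1 + of_real t * (of_real r * cis \<theta>)))" for \<theta>
  define c where "c \<theta> k = (-1) ^ (k + 1) * (r ^ k * cos (real k * \<theta>) / real (k + 2))" for \<theta> and k :: nat
  have r: "0 < r" "r \<le> 1"
    using assms(1) by auto
  \<comment> \<open>The range includes 0, the angle of the comparison series, and stops before pi,
    where r = 1 would hit the pole.\<close>
  have ne: "of_real r * cis \<theta> \<noteq> -1" if "\<theta> \<in> {0..<pi}" for \<theta>
  proof
    assume eq: "of_real r * cis \<theta> = -1"
    then have "norm (of_real r * cis \<theta>) = 1"
      by simp
    then have "r = 1"
      using r by (simp add: norm_mult)
    with eq have "cos \<theta> = cos pi"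
      by (simp add: complex_eq_iff)
    then show False
      using that cos_inj_pi[of \<theta> pi] by auto
  qed
  have zero: "0 \<in> {0..<pi}" and \<phi>: "\<phi> \<in> {0..<pi}"
    using assms(2) by auto
  have norm_le: "norm (of_real r * cis \<theta>) \<le> 1" for \<theta>
    using r by (simp add: norm_mult)
  \<comment> \<open>The sign \<open>(-1) ^ (k + 1)\<close> turns the series from index 0 into
    \<open>- Re (J \<theta>)\<close>. Dropping the term of index 0, which is -1/2 for every angle,
    adds 1/2.\<close>
  have c_sums: "(\<lambda>n. c \<theta> (Suc n)) sums (1 / 2 - Re (J \<theta>))" if "\<theta> \<in> {0..<pi}" for \<theta>
  proof -
    have "(\<lambda>n. - Re ((- (of_real r * cis \<theta>)) ^ n / of_nat (n + 2))) sums - Re (J \<theta>)"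
      unfolding J_def by (intro sums_minus sums_Re sums_integral_unit ne norm_le that)
    moreover have "- Re ((- (of_real r * cis \<theta>)) ^ n / of_nat (n + 2)) = c \<theta> n" for n
    proof -
      have "(- (of_real r * cis \<theta>)) ^ n = of_real ((-1) ^ n * r ^ n) * cis (real n * \<theta>)"
        by (simp add: power_minus[of "of_real r * cis \<theta>"] power_mult_distrib Complex.DeMoivre)
      then show ?thesis
        by (simp add: c_def del: of_real_mult of_real_power of_nat_add)
    qed
    ultimately have "c \<theta> sums - Re (J \<theta>)"
      by simp
    moreover have "c \<theta> 0 = - (1 / 2)"
      by (simp add: c_def)
    ultimately show ?thesis
      by (simp only: sums_Suc_iff) simp
  qed
  \<comment> \<open>The sums are 1/2 minus these values, so the order is reversed in the
    conclusion.\<close>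
  have "Re (J 0) < Re (J \<phi>)"
  proof -
    have cont: "continuous_on {0..1} (\<lambda>t. of_real t / (1 + of_real t * (of_real r * cis \<theta>)))"
      if "\<theta> \<in> {0..<pi}" for \<theta>
      by (intro continuous_on_div_one_plus_scaled ne norm_le that continuous_intros)
    have Re_J: "Re (J \<theta>) = integral {0..1} (\<lambda>t. Re (of_real t / (1 + of_real t * (of_real r * cis \<theta>))))"
      if "\<theta> \<in> {0..<pi}" for \<theta>
      unfolding J_def
      using integral_linear[OF integrable_continuous_real[OF cont[OF that]] bounded_linear_Re]
      by (simp add: o_def)
    have "cos \<phi> < cos 0"
      using assms(2) by (intro cos_monotone_0_pi) auto
    \<comment> \<open>Strictness can hold only in the open interval: both sides vanish at t = 0, and
      for r = 1 both equal 1/2 at t = 1. With continuity this is enough for strict inequality of the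
      integrals.\<close>
    then have less: "Re (of_real t / (1 + of_real t * (of_real r * cis 0)))
        < Re (of_real t / (1 + of_real t * (of_real r * cis \<phi>)))" if t: "t \<in> {0<..<1}" for t
    proof -
      have "t * r < 1"
        using t r mult_left_le[of r t] unfolding greaterThanLessThan_iff by linarith
      then have "t * Re (1 / (1 + of_real (t * r))) < t * Re (1 / (1 + of_real (t * r) * cis \<phi>))"
        using t r \<open>cos \<phi> < cos 0\<close> by (intro mult_strict_left_mono Re_inverse_one_plus_less) auto
      moreover have "t * Re (1 / z) = Re (of_real t / z)" for z
        by (metis Re_complex_of_real mult.right_neutral scaleR_complex.sel(1) scaleR_conv_of_real times_divide_eq_right)
      ultimately show ?thesis
        by (simp add: mult.assoc)
    qed
    show ?thesis
      unfolding Re_J[OF zero] Re_J[OF \<phi>]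
      by (intro integral_less_real continuous_on_Re cont zero \<phi> less) auto
  qed
  moreover have "a = c \<phi>" "b = c 0"
    by (auto simp: a_def b_def c_def)
  ultimately show ?thesis
    using c_sums[OF \<phi>] c_sums[OF zero] by (auto simp: sums_iff)
qed

end
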